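(* Write $\dfrac{(q;q)_\infty^2}{(q^5;q^5)_\infty^3}=\sum_{n\ge0}a_nq^n$. Then for all $n\ge0$: $a_n>0$ if $n\equiv0,3,4\pmod5$, and $a_n<0$ if $n\equiv1,2\pmod5$.
   Context: For $|q|<1$, $(a;q)_\infty=\prod_{k\ge0}(1-aq^k)$. *)

theory Defs
  imports "HOL-Computational_Algebra.Formal_Power_Series"
begin

text \<open>The q-Pochhammer symbol (q^m;q^m)_\<infinity> = \<Prod>_{k\<ge>0} (1 - q^(m(k+1))) as a formal
  power series in q. For m \<ge> 1 the factors with k \<ge> n are 1 modulo q^(n+1), so the
  n-th coefficient of the infinite product equals that of the finite product over k < n.\<close>
definition qpoch_inf_fps :: "nat \<Rightarrow> real fps" where
  "qpoch_inf_fps m = Abs_fps (\<lambda>n. fps_nth (\<Prod>k<n. (1 - fps_X ^ (m * (k + 1)))) n)"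

definition thm_series :: "real fps" where
  "thm_series = qpoch_inf_fps 1 ^ 2 * inverse (qpoch_inf_fps 5 ^ 3)"

end

theory Submission
  imports Defs
begin

text \<open>With \<open>A = (q^5, q^20; q^25)\<close>, \<open>B = (q^10, q^15; q^25)\<close> and \<open>F = (q^25; q^25)\<close>, Ramanujan's
  5-dissection reads \<open>(q; q) = F (B/A - q - q^2 A/B)\<close>, whereas \<open>(q^5; q^5) = A B F\<close>. Hence the series is
  \<open>1/F\<close> times
  \<open>1/(A^5 B) - 2 q/(A^4 B^2) - q^2/(A^3 B^3) + 2 q^3/(A^2 B^4) + q^4/(A B^5)\<close>.
  Every product inverted here is a product of factors \<open>1 - q^(5m)\<close> including \<open>1 - q^5\<close>, so each of the
  five terms has coefficients of one sign on exactly one residue class modulo 5. The dissection follows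
  from the pentagonal number theorem by splitting the summation index modulo 5; the class 1 gives
  \<open>- q F\<close>, and the other four combine in pairs by the quintuple product identity.\<close>

section \<open>Formal sums of monomials\<close>

text \<open>Collecting a possibly infinite sum by exponent avoids any topology: rearrangements
  become bijections of index sets. Integer exponents keep quadratic forms free of truncated
  subtraction.\<close>

definition fsum :: "('i \<Rightarrow> int) \<Rightarrow> ('i \<Rightarrow> real) \<Rightarrow> 'i set \<Rightarrow> real fps" where
  "fsum e c I = Abs_fps (\<lambda>n. \<Sum>i | i \<in> I \<and> e i = int n. c i)"

text \<open>Both clauses guard against silent loss: \<open>fsum\<close> drops negative exponents,
  and a sum over an infinite level set is 0 by convention.\<close>

definition summable_exp :: "('i \<Rightarrow> int) \<Rightarrow> 'i set \<Rightarrow> bool" where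
  "summable_exp e I \<longleftrightarrow> (\<forall>i\<in>I. 0 \<le> e i) \<and> (\<forall>n. finite {i \<in> I. e i = int n})"

lemma fsum_nth: "fps_nth (fsum e c I) n = (\<Sum>i | i \<in> I \<and> e i = int n. c i)"
  by (simp add: fsum_def)

lemma fsum_reindex:
  assumes "bij_betw h J I" "\<And>j. j \<in> J \<Longrightarrow> e (h j) = e' j" "\<And>j. j \<in> J \<Longrightarrow> c (h j) = c' j"
  shows "fsum e c I = fsum e' c' J"
proof (rule fps_ext)
  fix n
  have "bij_betw h {j \<in> J. e' j = int n} {i \<in> I. e i = int n}"
    using assms(1,2) by (auto simp: bij_betw_def inj_on_def)
  then show "fps_nth (fsum e c I) n = fps_nth (fsum e' c' J) n"
    unfolding fsum_nth using sum.reindex_bij_betw[of h _ _ c] assms(3)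
    by (smt (verit, best) mem_Collect_eq sum.cong)
qed

lemma fsum_reindex2:
  assumes "bij_betw h K I" "bij_betw h' K J" "\<And>k. k \<in> K \<Longrightarrow> e (h k) = e' (h' k)"
    "\<And>k. k \<in> K \<Longrightarrow> c (h k) = c' (h' k)"
  shows "fsum e c I = fsum e' c' J"
  using fsum_reindex[OF assms(1), of e "\<lambda>k. e' (h' k)" c "\<lambda>k. c' (h' k)"]
    fsum_reindex[OF assms(2), of e' "\<lambda>k. e' (h' k)" c' "\<lambda>k. c' (h' k)"] assms(3,4) by simp

lemma fsum_Un:
  assumes "summable_exp e UNIV" "I \<inter> J = {}"
  shows "fsum e c (I \<union> J) = fsum e c I + fsum e c J"
proof (rule fps_ext)
  fix n
  have "finite {i \<in> I. e i = int n}" "finite {i \<in> J. e i = int n}"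
    using assms(1) unfolding summable_exp_def by (auto intro: rev_finite_subset)
  moreover have "{i \<in> I \<union> J. e i = int n} = {i \<in> I. e i = int n} \<union> {i \<in> J. e i = int n}"
    by auto
  ultimately show "fps_nth (fsum e c (I \<union> J)) n = fps_nth (fsum e c I + fsum e c J) n"
    using assms(2) by (simp add: fsum_nth) (subst sum.union_disjoint; auto)
qed

lemma fsum_uminus: "fsum e (\<lambda>i. - c i) I = - fsum e c I"
  by (rule fps_ext) (simp add: fsum_nth sum_negf)

lemma fsum_X_power:
  assumes "summable_exp e I"
  shows "fsum (\<lambda>i. int k + e i) c I = fps_X ^ k * fsum e c I"
proof (rule fps_ext)
  fix n
  have "{i \<in> I. int k + e i = int n} = (if n < k then {} else {i \<in> I. e i = int (n - k)})"
    using assms by (auto simp: summable_exp_def of_nat_diff)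
  then show "fps_nth (fsum (\<lambda>i. int k + e i) c I) n = fps_nth (fps_X ^ k * fsum e c I) n"
    by (simp add: fsum_nth fps_X_power_mult_nth)
qed

text \<open>Nonnegativity confines the first exponent to 0..n, so the level set is a finite union of
  rectangles; this makes the Cauchy product work.\<close>

lemma level_set_Times:
  assumes "summable_exp e I" "summable_exp e' J"
  shows "{p \<in> I \<times> J. e (fst p) + e' (snd p) = int n} =
     (\<Union>m\<le>n. {i \<in> I. e i = int m} \<times> {j \<in> J. e' j = int (n - m)})" (is "?L = ?R")
proof
  show "?L \<subseteq> ?R"
  proof
    fix p assume p: "p \<in> ?L"
    then have "0 \<le> e (fst p)" "0 \<le> e' (snd p)" using assms by (auto simp: summable_exp_def)
    then show "p \<in> ?R" using p
      by (intro UN_I[of "nat (e (fst p))"]) (auto simp: of_nat_diff)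
  qed
  show "?R \<subseteq> ?L" by (auto simp: of_nat_diff)
qed

lemma summable_exp_Times:
  assumes "summable_exp e I" "summable_exp e' J"
  shows "summable_exp (\<lambda>p. e (fst p) + e' (snd p)) (I \<times> J)"
proof -
  have "finite {i \<in> I. e i = int m}" "finite {j \<in> J. e' j = int m}" for m
    using assms by (auto simp: summable_exp_def)
  then have "finite {p \<in> I \<times> J. e (fst p) + e' (snd p) = int n}" for n
    unfolding level_set_Times[OF assms]
    by (intro finite_UN_I finite_cartesian_product finite_atMost)
  then show ?thesis using assms by (auto simp: summable_exp_def)
qed

lemma fsum_mult:
  assumes "summable_exp e I" "summable_exp e' J"
  shows "fsum e c I * fsum e' c' J =
         fsum (\<lambda>p. e (fst p) + e' (snd p)) (\<lambda>p. c (fst p) * c' (snd p)) (I \<times> J)"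
proof (rule fps_ext)
  fix n
  let ?A = "\<lambda>m. {i \<in> I. e i = int m}" and ?B = "\<lambda>m. {j \<in> J. e' j = int m}"
  have fin: "finite (?A m)" "finite (?B m)" for m using assms by (auto simp: summable_exp_def)
  have "fps_nth (fsum e c I * fsum e' c' J) n = (\<Sum>m\<le>n. (\<Sum>i\<in>?A m. c i) * (\<Sum>j\<in>?B (n - m). c' j))"
    by (simp add: fps_mult_nth fsum_nth atMost_atLeast0)
  also have "\<dots> = (\<Sum>m\<le>n. \<Sum>p\<in>?A m \<times> ?B (n - m). c (fst p) * c' (snd p))"
    by (simp add: sum_product sum.cartesian_product case_prod_beta)
  also have "\<dots> = (\<Sum>p\<in>(\<Union>m\<le>n. ?A m \<times> ?B (n - m)). c (fst p) * c' (snd p))"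
    by (rule sum.UNION_disjoint[symmetric]) (blast intro: fin | auto)+
  also have "\<dots> = (\<Sum>p | p \<in> I \<times> J \<and> e (fst p) + e' (snd p) = int n. c (fst p) * c' (snd p))"
    by (subst level_set_Times[OF assms, symmetric]) simp
  finally show "fps_nth (fsum e c I * fsum e' c' J) n = fps_nth (fsum (\<lambda>p. e (fst p) + e' (snd p))
      (\<lambda>p. c (fst p) * c' (snd p)) (I \<times> J)) n" by (simp add: fsum_nth)
qed

section \<open>Theta series and the quintuple product identity\<close>

definition tri :: "int \<Rightarrow> int" where "tri j = j * (j - 1) div 2"

lemma two_tri: "2 * tri j = j * (j - 1)"
  unfolding tri_def by (rule dvd_mult_div_cancel) auto

lemma tri_Suc: "tri (j + 1) = tri j + j"
  using two_tri[of j] two_tri[of "j + 1"] by (simp add: algebra_simps)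

definition sg :: "int \<Rightarrow> real" where "sg j = (if even j then 1 else -1)"

lemma summable_exp_int:
  assumes "\<And>j::int. \<bar>j\<bar> \<le> e j"
  shows "summable_exp e UNIV"
  unfolding summable_exp_def
proof (intro conjI allI ballI)
  fix n
  have "{i \<in> UNIV. e i = int n} \<subseteq> {- int n..int n}"
  proof
    fix x assume "x \<in> {i \<in> UNIV. e i = int n}"
    then show "x \<in> {- int n..int n}" using assms[of x] by auto
  qed
  then show "finite {i \<in> UNIV. e i = int n}" by (rule finite_subset) simp
next
  fix j show "0 \<le> e j" using assms[of j] by linarith
qed

definition theta_exp :: "nat \<Rightarrow> nat \<Rightarrow> int \<Rightarrow> int" where
  "theta_exp M r j = int M * tri j + int r * j"

text \<open>The series side of the Jacobi triple product in base q^M at z = q^r.\<close>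

definition theta :: "nat \<Rightarrow> nat \<Rightarrow> real fps" where
  "theta M r = fsum (theta_exp M r) sg UNIV"

text \<open>Besides summability, this bound later makes terms far from the centre vanish modulo
  q^N.\<close>

lemma theta_exp_ge:
  assumes "0 < r" "r < M"
  shows "\<bar>j\<bar> \<le> theta_exp M r j"
proof (cases "j \<ge> 1")
  case True
  then have "0 \<le> tri j" by (simp add: tri_def)
  moreover have "1 * j \<le> int r * j" using assms True by (intro mult_right_mono) auto
  ultimately show ?thesis using True assms by (simp add: theta_exp_def add_increasing)
next
  case False
  \<comment> \<open>Under j = -i the exponent becomes M tri i + (M - r) i, the same shape with r
    replaced by M - r.\<close>
  define i where "i = - j"
  have i: "i \<ge> 0" "j = - i" using False by (auto simp: i_def)
  have "tri j = tri i + i" using two_tri[of j] two_tri[of i] i by (simp add: algebra_simps)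
  moreover have "0 \<le> tri i" using i by (cases "i = 0") (auto simp: tri_def)
  ultimately have "tri j \<ge> i" by simp
  then have "int M * tri j \<ge> int M * i" by (intro mult_left_mono) auto
  moreover have "1 * i \<le> (int M - int r) * i" using assms i by (intro mult_right_mono) auto
  ultimately show ?thesis using i by (simp add: theta_exp_def algebra_simps)
qed

lemma summable_exp_theta: "0 < r \<Longrightarrow> r < M \<Longrightarrow> summable_exp (theta_exp M r) UNIV"
  by (rule summable_exp_int) (rule theta_exp_ge)

definition quint_exp1 :: "nat \<Rightarrow> nat \<Rightarrow> int \<Rightarrow> int" where
  "quint_exp1 M s k = 3 * int M * tri k + (int M + 3 * int s) * k"

definition quint_exp2 :: "nat \<Rightarrow> nat \<Rightarrow> int \<Rightarrow> int" where
  "quint_exp2 M s k = 3 * int M * tri k + (3 * int s - int M) * k + int M - 2 * int s"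

text \<open>With Q = q^M and z = q^s, and k shifted by one in the second sum, this is the sum of
  (-1)^k Q^(k(3k-1)/2) z^(3k) (1 + z Q^k), the series side of the quintuple product.\<close>

definition quint :: "nat \<Rightarrow> nat \<Rightarrow> real fps" where
  "quint M s = fsum (quint_exp1 M s) sg UNIV - fsum (quint_exp2 M s) sg UNIV"

lemma summable_exp_quint1:
  assumes "0 < s" "2 * s < M"
  shows "summable_exp (quint_exp1 M s) UNIV"
proof (rule summable_exp_int)
  fix j :: int
  have "quint_exp1 M s j = theta_exp (3 * M) (M + 3 * s) j"
    by (simp add: quint_exp1_def theta_exp_def)
  then show "\<bar>j\<bar> \<le> quint_exp1 M s j" using theta_exp_ge[of "M + 3 * s" "3 * M"] assms by simp
qed

text \<open>The linear coefficient 3s - M may be negative, so the bound for \<open>theta_exp\<close>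
  does not apply and tri k is estimated directly.\<close>

lemma summable_exp_quint2:
  assumes "0 < s" "2 * s < M"
  shows "summable_exp (quint_exp2 M s) UNIV"
proof (rule summable_exp_int)
  fix k :: int
  show "\<bar>k\<bar> \<le> quint_exp2 M s k"
  proof (cases "k \<ge> 1")
    case True
    have "2 * (k - 1) \<le> k * (k - 1)" if "k \<noteq> 1" using True that by (intro mult_right_mono) auto
    then have "k - 1 \<le> tri k" using two_tri[of k] by (cases "k = 1") auto
    then have "3 * int M * (k - 1) \<le> 3 * int M * tri k" by (intro mult_left_mono) auto
    \<comment> \<open>The exponent is at least (2M + 3s)(k - 1) + s; the summand s >= 1 supplies the
      missing unit.\<close>
    moreover have "1 * (k - 1) \<le> (2 * int M + 3 * int s) * (k - 1)"
      using assms True by (intro mult_right_mono) auto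
    ultimately show ?thesis using assms True by (simp add: quint_exp2_def algebra_simps)
  next
    case False
    have "(- k) * 2 \<le> (- k) * (1 - k)" if "k \<noteq> 0" using False that by (intro mult_left_mono) auto
    then have "- k \<le> tri k" using two_tri[of k] by (cases "k = 0") (auto simp: algebra_simps)
    then have "3 * int M * (- k) \<le> 3 * int M * tri k" by (intro mult_left_mono) auto
    moreover have "1 * (- k) \<le> (4 * int M - 3 * int s) * (- k)"
      using assms False by (intro mult_right_mono) auto
    ultimately show ?thesis using assms False by (simp add: quint_exp2_def algebra_simps)
  qed
qed

lemma sg_mult: "sg i * sg j = sg (i + j)"
  by (auto simp: sg_def)

text \<open>Completing squares turns the exponents of each product of two theta series into values of the
  form \<open>x^2 + 3 y^2\<close>, and multiplication by a cube root of unity in the Eisenstein integers permutes the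
  index pairs. Of the four half-sums on the left, two cancel and two make up the right-hand side.\<close>
lemma quintuple_product:
  assumes s: "0 < s" "2 * s < M"
  shows "theta M s * quint M s = theta M (2 * s) * theta (3 * M) M"
proof -
  define c :: "int \<times> int \<Rightarrow> real" where "c = (\<lambda>p. sg (fst p + snd p))"
  define e1 where "e1 = (\<lambda>p. theta_exp M s (fst p) + quint_exp1 M s (snd p))"
  define e2 where "e2 = (\<lambda>p. theta_exp M s (fst p) + quint_exp2 M s (snd p))"
  define e3 where "e3 = (\<lambda>p. theta_exp M (2 * s) (fst p) + theta_exp (3 * M) M (snd p))"
  \<comment> \<open>The sign c is 1 on \<open>EV\<close> and -1 on \<open>OD\<close>, so comparing
    half-sums only requires matching exponents.\<close>
  define EV where "EV = {p :: int \<times> int. even (fst p + snd p)}"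
  define OD where "OD = {p :: int \<times> int. odd (fst p + snd p)}"
  have sum: "summable_exp e1 UNIV" "summable_exp e2 UNIV" "summable_exp e3 UNIV"
    unfolding e1_def e2_def e3_def using s
    by (auto intro!: summable_exp_Times[of _ UNIV _ UNIV, unfolded UNIV_Times_UNIV]
        summable_exp_theta summable_exp_quint1 summable_exp_quint2)
  have split: "fsum e c UNIV = fsum e c EV + fsum e c OD" if "summable_exp e UNIV" for e
  proof -
    have "EV \<union> OD = UNIV" "EV \<inter> OD = {}" by (auto simp: EV_def OD_def)
    then show ?thesis using fsum_Un[OF that, of EV OD c] by simp
  qed
  have A: "theta M s * quint M s = fsum e1 c UNIV - fsum e2 c UNIV"
    unfolding theta_def quint_def right_diff_distrib e1_def e2_def c_def
    using s by (simp add: fsum_mult summable_exp_theta summable_exp_quint1 summable_exp_quint2 sg_mult)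
  have B: "theta M (2 * s) * theta (3 * M) M = fsum e3 c UNIV"
    unfolding theta_def e3_def c_def using s by (simp add: fsum_mult summable_exp_theta sg_mult)
  \<comment> \<open>Following the inverse of the first map by the second gives (x, y) -> ((x +
    3y)/2, (x - y)/2), which preserves x^2 + 3y^2 and is integral exactly for x + y even.\<close>
  have bij: "bij_betw (\<lambda>(a, k). (2 * a - k, k)) UNIV EV"
    "bij_betw (\<lambda>(a, k). (a + k, a - k)) UNIV EV"
    "bij_betw (\<lambda>(a, k). (a + k - 1, k - a)) UNIV OD"
    "bij_betw (\<lambda>(a, k). (2 * a + 1 - k, k)) UNIV OD"
    "bij_betw (\<lambda>(a, k). (2 * k - a, a + 1)) UNIV OD"
  proof -
    show "bij_betw (\<lambda>(a, k). (2 * a - k, k)) UNIV EV"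
      by (rule bij_betw_byWitness[where f' = "\<lambda>(x, y). ((x + y) div 2, y)"]) (auto simp: EV_def)
    show "bij_betw (\<lambda>(a, k). (a + k, a - k)) UNIV EV"
      by (rule bij_betw_byWitness[where f' = "\<lambda>(x, y). ((x + y) div 2, (x - y) div 2)"])
        (auto simp: EV_def; presburger)+
    show "bij_betw (\<lambda>(a, k). (a + k - 1, k - a)) UNIV OD"
      by (rule bij_betw_byWitness[where f' = "\<lambda>(x, y). ((x - y + 1) div 2, (x + y + 1) div 2)"])
        (auto simp: OD_def; presburger)+
    show "bij_betw (\<lambda>(a, k). (2 * a + 1 - k, k)) UNIV OD"
      by (rule bij_betw_byWitness[where f' = "\<lambda>(x, y). ((x + y) div 2, y)"])
        (auto simp: OD_def; presburger)+
    show "bij_betw (\<lambda>(a, k). (2 * k - a, a + 1)) UNIV OD"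
      by (rule bij_betw_byWitness[where f' = "\<lambda>(x, y). (y - 1, (x + y - 1) div 2)"])
        (auto simp: OD_def; presburger)+
  qed
  have R1: "fsum e3 c EV = fsum e1 c EV"
  proof (rule fsum_reindex2[OF bij(2) bij(1)], goal_cases)
    case (1 p)
    obtain a k where p: "p = (a, k)" by (cases p)
    have "tri (a + k) + 3 * tri (a - k) + (a - k) = tri (2 * a - k) + 3 * tri k + k"
      using two_tri[of "a + k"] two_tri[of "a - k"] two_tri[of "2 * a - k"] two_tri[of k]
      by (simp add: algebra_simps)
    \<comment> \<open>The parts with coefficient s agree as they stand; only the part with
      coefficient M needs the identity of triangular numbers.\<close>
    from arg_cong[OF this, of "\<lambda>x. int M * x"] show ?case
      by (simp add: e3_def e1_def theta_exp_def quint_exp1_def p algebra_simps)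
  qed (auto simp: c_def sg_def)
  have R2: "fsum e3 c OD = - fsum e2 c EV"
    unfolding fsum_uminus[symmetric]
  proof (rule fsum_reindex2[OF bij(3) bij(1)], goal_cases)
    case (1 p)
    obtain a k where p: "p = (a, k)" by (cases p)
    have "tri (a + k - 1) + 3 * tri (k - a) + (k - a) = tri (2 * a - k) + 3 * tri k - k + 1"
      using two_tri[of "a + k - 1"] two_tri[of "k - a"] two_tri[of "2 * a - k"] two_tri[of k]
      by (simp add: algebra_simps)
    from arg_cong[OF this, of "\<lambda>x. int M * x"] show ?case
      by (simp add: e3_def e2_def theta_exp_def quint_exp2_def p algebra_simps)
  qed (auto simp: c_def sg_def)
  \<comment> \<open>These odd halves cancel in the difference coming from
    \<open>quint\<close>.\<close>
  have R3: "fsum e2 c OD = fsum e1 c OD"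
  proof (rule fsum_reindex2[OF bij(5) bij(4)], goal_cases)
    case (1 p)
    obtain a k where p: "p = (a, k)" by (cases p)
    have "tri (2 * k - a) + 3 * tri (a + 1) - (a + 1) + 1 = tri (2 * a + 1 - k) + 3 * tri k + k"
      using two_tri[of "2 * k - a"] two_tri[of "a + 1"] two_tri[of "2 * a + 1 - k"] two_tri[of k]
      by (simp add: algebra_simps)
    from arg_cong[OF this, of "\<lambda>x. int M * x"] show ?case
      by (simp add: e2_def e1_def theta_exp_def quint_exp1_def quint_exp2_def p algebra_simps)
  qed (auto simp: c_def sg_def)
  show ?thesis
    using R1 R2 R3 split sum unfolding A B by simp
qed

section \<open>Infinite products\<close>

text \<open>Congruence modulo q^N replaces limits: an identity of infinite products is checked
  modulo every power of q.\<close>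

definition fps_cong :: "nat \<Rightarrow> real fps \<Rightarrow> real fps \<Rightarrow> bool" where
  "fps_cong N F G \<longleftrightarrow> (\<forall>i<N. fps_nth F i = fps_nth G i)"

lemma fps_cong_refl [simp]: "fps_cong N F F"
  and fps_cong_sym: "fps_cong N F G \<Longrightarrow> fps_cong N G F"
  and fps_cong_trans [trans]: "fps_cong N F G \<Longrightarrow> fps_cong N G H \<Longrightarrow> fps_cong N F H"
  by (auto simp: fps_cong_def)

lemma fps_cong_mult:
  assumes "fps_cong N F F'" "fps_cong N G G'"
  shows "fps_cong N (F * G) (F' * G')"
  unfolding fps_cong_def
proof (intro allI impI)
  fix i assume "i < N"
  then show "fps_nth (F * G) i = fps_nth (F' * G') i"
    unfolding fps_mult_nth using assms by (intro sum.cong refl) (auto simp: fps_cong_def)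
qed

lemma fps_cong_sum:
  assumes "\<And>x. x \<in> A \<Longrightarrow> fps_cong N (f x) (g x)"
  shows "fps_cong N (\<Sum>x\<in>A. f x) (\<Sum>x\<in>A. g x)"
  using assms by (auto simp: fps_cong_def fps_sum_nth intro!: sum.cong)

lemma fps_cong_X_power: "N \<le> e \<Longrightarrow> fps_cong N (fps_X ^ e * F) 0"
  by (auto simp: fps_cong_def fps_X_power_mult_nth)

lemma fps_eqI_cong: "(\<And>N. fps_cong N F G) \<Longrightarrow> F = G"
  by (rule fps_ext) (auto simp: fps_cong_def)

lemma fps_cong_inverse:
  assumes "fps_cong N F G" "fps_nth F 0 \<noteq> 0" "fps_nth G 0 \<noteq> 0"
  shows "fps_cong N (inverse F) (inverse G)"
proof -
  have "fps_cong N (inverse F * inverse G * F) (inverse F * inverse G * G)"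
    by (intro fps_cong_mult assms(1) fps_cong_refl)
  moreover have "inverse F * inverse G * F = inverse G" "inverse F * inverse G * G = inverse F"
    using inverse_mult_eq_1[OF assms(2)] inverse_mult_eq_1[OF assms(3)]
    by (simp_all add: mult_ac)
  ultimately show ?thesis by (simp add: fps_cong_sym)
qed

definition pprod :: "nat \<Rightarrow> nat \<Rightarrow> nat \<Rightarrow> real fps" where
  "pprod r M n = (\<Prod>k<n. 1 - fps_X ^ (r + M * k))"

text \<open>For r, M > 0 this is (q^r; q^M)_inf: factors with index at least n are 1 modulo q^(n+1),
  so the n-th coefficient is final after n factors.\<close>

definition iprod :: "nat \<Rightarrow> nat \<Rightarrow> real fps" where
  "iprod r M = Abs_fps (\<lambda>n. fps_nth (pprod r M n) n)"

lemma qpoch_inf_fps_eq_iprod: "qpoch_inf_fps m = iprod m m"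
  by (simp add: qpoch_inf_fps_def iprod_def pprod_def algebra_simps)

lemma pprod_0 [simp]: "pprod r M 0 = 1"
  and pprod_Suc [simp]: "pprod r M (Suc n) = pprod r M n * (1 - fps_X ^ (r + M * n))"
  by (simp_all add: pprod_def)

lemma pprod_stable:
  assumes "0 < r" "0 < M" "n \<le> K"
  shows "fps_nth (pprod r M K) n = fps_nth (pprod r M n) n"
  using assms(3)
proof (induction K rule: dec_induct)
  case (step K)
  have "1 * K \<le> M * K" using assms by (intro mult_right_mono) auto
  then have "n < r + M * K" using step assms by linarith
  then have "fps_nth (pprod r M K * fps_X ^ (r + M * K)) n = 0"
    by (simp add: fps_X_power_mult_right_nth)
  then show ?case using step by (simp add: algebra_simps)
qed simp

lemma iprod_cong:
  assumes "0 < r" "0 < M" "N \<le> Suc K"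
  shows "fps_cong N (iprod r M) (pprod r M K)"
  unfolding fps_cong_def
proof (intro allI impI)
  fix i assume "i < N"
  then have "i \<le> K" using assms by simp
  from pprod_stable[OF assms(1,2) this] show "fps_nth (iprod r M) i = fps_nth (pprod r M K) i"
    by (simp add: iprod_def)
qed

lemma pprod_nth_0: "0 < r \<Longrightarrow> fps_nth (pprod r M n) 0 = 1"
  by (induction n) auto

lemma iprod_nth_0: "0 < r \<Longrightarrow> fps_nth (iprod r M) 0 = 1"
  by (simp add: iprod_def)

section \<open>The Jacobi triple product\<close>

text \<open>The Gaussian binomial in base q^M. The value 0 for k > n lets the Pascal rules hold at
  the boundary and sums gain an extra index.\<close>

definition qbin :: "nat \<Rightarrow> nat \<Rightarrow> nat \<Rightarrow> real fps" where
  "qbin M n k = (if k \<le> n then pprod M M n * inverse (pprod M M k * pprod M M (n - k)) else 0)"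

lemma qbin_mult:
  assumes "0 < M" "k \<le> n"
  shows "qbin M n k * (pprod M M k * pprod M M (n - k)) = pprod M M n"
proof -
  have "fps_nth (pprod M M k * pprod M M (n - k)) 0 \<noteq> 0"
    using assms(1) by (simp add: pprod_nth_0)
  from inverse_mult_eq_1[OF this] show ?thesis
    using assms(2) by (simp only: qbin_def if_True mult.assoc mult_1_right)
qed

lemma qbin_0 [simp]: "0 < M \<Longrightarrow> qbin M n 0 = 1"
  using pprod_nth_0[of M M n] by (simp add: qbin_def inverse_mult_eq_1')

lemma qbin_n [simp]: "0 < M \<Longrightarrow> qbin M n n = 1"
  using pprod_nth_0[of M M n] by (simp add: qbin_def inverse_mult_eq_1')

lemma qbin_eqI:
  assumes "0 < M" "k \<le> n" "F * (pprod M M k * pprod M M (n - k)) = pprod M M n"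
  shows "qbin M n k = F"
proof -
  have "pprod M M k * pprod M M (n - k) \<noteq> 0"
    using assms(1) by (metis fps_mult_nth_0 fps_zero_nth mult_1_right pprod_nth_0 zero_neq_one)
  then show ?thesis using qbin_mult[OF assms(1,2)] assms(3) by (metis mult_right_cancel)
qed

text \<open>With Q = q^M, m = n - k - 1, u = 1 - Q^(k+1) and v = 1 - Q^(m+1), the first rule comes
  from v + Q^(m+1) u = 1 - Q^(n+1) over a common denominator; exchanging u and v gives the
  second.\<close>

lemma qbin_Suc_Suc:
  assumes "0 < M"
  shows "qbin M (Suc n) (Suc k) = qbin M n (Suc k) + fps_X ^ (M * (n - k)) * qbin M n k" (is ?A)
    and "qbin M (Suc n) (Suc k) = qbin M n k + fps_X ^ (M * Suc k) * qbin M n (Suc k)" (is ?B)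
proof -
  consider "k > n" | "k = n" | "k < n" by linarith
  then have "?A \<and> ?B"
  proof cases
    case 1 then show ?thesis by (simp add: qbin_def)
  next
    case 2 then show ?thesis using assms by (simp add: qbin_def[of M n "Suc n"])
  next
    case 3
    define m where "m = n - k - 1"
    have n: "n = Suc (k + m)" using 3 by (simp add: m_def)
    let ?x = "fps_X ^ M :: real fps"
    have p: "pprod M M (Suc j) = pprod M M j * (1 - ?x * ?x ^ j)" for j
      by (simp add: power_add power_mult)
    have a: "qbin M n k * (pprod M M k * (pprod M M m * (1 - ?x * ?x ^ m))) = pprod M M n"
      using qbin_mult[OF assms, of k n] by (simp add: n p del: pprod_Suc)
    have b: "qbin M n (Suc k) * (pprod M M k * (1 - ?x * ?x ^ k) * pprod M M m) = pprod M M n"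
      using qbin_mult[OF assms, of "Suc k" n] by (simp add: n p del: pprod_Suc)
    have c: "pprod M M (Suc n) = pprod M M n * (1 - ?x * (?x * (?x ^ k * ?x ^ m)))"
      by (simp add: p n power_add del: pprod_Suc)
    have X: "fps_X ^ (M * j) = ?x ^ j" for j by (simp add: power_mult)
    define P where "P = pprod M M k * pprod M M m"
    define u v where "u = 1 - ?x * ?x ^ k" and "v = 1 - ?x * ?x ^ m"
    have a': "qbin M n k * P * v = pprod M M n" and b': "qbin M n (Suc k) * P * u = pprod M M n"
      using a b by (simp_all add: P_def u_def v_def mult_ac)
    have k': "pprod M M (Suc k) * pprod M M (Suc n - Suc k) = P * u * v"
      by (simp add: n p P_def u_def v_def mult_ac del: pprod_Suc)
    have alg: "(q + x * z * q') * (P' * u' * v') = D * (1 - x * (x * (y * z)))"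
      if "q * P' * u' = D" "q' * P' * v' = D" "u' = 1 - x * y" "v' = 1 - x * z"
      for q q' P' u' v' D x y z :: "real fps"
    proof -
      have "(q + x * z * q') * (P' * u' * v') = (q * P' * u') * v' + x * z * u' * (q' * P' * v')"
        by (simp only: distrib_left distrib_right mult_ac)
      also have "\<dots> = D * (v' + x * z * u')"
        unfolding that(1,2) by (simp only: distrib_left distrib_right mult_ac)
      also have "v' + x * z * u' = 1 - x * (x * (y * z))"
        unfolding that(3,4) by (simp add: right_diff_distrib mult_ac)
      finally show ?thesis .
    qed
    have A: ?A
    proof (rule qbin_eqI)
      show "(qbin M n (Suc k) + fps_X ^ (M * (n - k)) * qbin M n k) *
          (pprod M M (Suc k) * pprod M M (Suc n - Suc k)) = pprod M M (Suc n)"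
        unfolding k' c X using alg[OF b' a' u_def v_def] n by simp
    qed (use assms 3 in simp_all)
    have B: ?B
    proof (rule qbin_eqI)
      show "(qbin M n k + fps_X ^ (M * Suc k) * qbin M n (Suc k)) *
          (pprod M M (Suc k) * pprod M M (Suc n - Suc k)) = pprod M M (Suc n)"
        unfolding k' c X using alg[OF a' b' v_def u_def] by (simp add: mult_ac)
    qed (use assms 3 in simp_all)
    from A B show ?thesis ..
  qed
  then show ?A ?B by blast+
qed

definition theta_term :: "nat \<Rightarrow> nat \<Rightarrow> int \<Rightarrow> real fps" where
  "theta_term M r j = fps_const (sg j) * fps_X ^ nat (theta_exp M r j)"

text \<open>Trades the power of q in a new factor for the power in a Pascal rule, passing to a term
  of opposite sign.\<close>

lemma theta_term_mult:
  assumes "0 < r" "r < M" "theta_exp M r i + int d = theta_exp M r j + int e" "odd (i - j)"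
  shows "theta_term M r i * fps_X ^ d = - (theta_term M r j * fps_X ^ e)"
proof -
  have "nat (theta_exp M r i) + d = nat (theta_exp M r j) + e"
    using theta_exp_ge[OF assms(1,2), of i] theta_exp_ge[OF assms(1,2), of j] assms(3) by linarith
  moreover have "sg i = - sg j" using assms(4) by (auto simp: sg_def)
  ultimately show ?thesis
    by (simp add: theta_term_def mult.assoc flip: power_add fps_const_neg)
qed

text \<open>The truncations to \<open>a\<close> and \<open>b\<close> factors are independent, so that each induction step
  adds a single factor and uses one of the two Pascal rules.\<close>
lemma finite_triple_product:
  assumes r: "0 < r" "r < M"
  shows "pprod r M a * pprod (M - r) M b =
    (\<Sum>i\<le>a + b. theta_term M r (int i - int b) * qbin M (a + b) i)"
proof (induction a)
  case 0
  show ?case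
  proof (induction b)
    case 0
    show ?case using r by (simp add: theta_term_def theta_exp_def sg_def tri_def)
  next
    case (Suc b)
    let ?t = "\<lambda>i. theta_term M r (int i - int (Suc b))"
    have t: "theta_term M r (int i - int b) * fps_X ^ (M - r + M * b) = - (?t i * fps_X ^ (M * i))" for i
    proof (rule theta_term_mult[OF r])
      have "int i - int b = (int i - int (Suc b)) + 1" by simp
      then show "theta_exp M r (int i - int b) + int (M - r + M * b) =
            theta_exp M r (int i - int (Suc b)) + int (M * i)"
        unfolding theta_exp_def
        using arg_cong[OF tri_Suc[of "int i - int (Suc b)"], of "\<lambda>x. int M * x"] r
        by (simp add: algebra_simps of_nat_diff)
    qed simp
    have "pprod r M 0 * pprod (M - r) M (Suc b) =
        (\<Sum>i\<le>b. theta_term M r (int i - int b) * qbin M b i) * (1 - fps_X ^ (M - r + M * b))"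
      using Suc by simp
    also have "\<dots> = (\<Sum>i\<le>b. theta_term M r (int i - int b) * qbin M b i) -
         (\<Sum>i\<le>b. (theta_term M r (int i - int b) * fps_X ^ (M - r + M * b)) * qbin M b i)"
      unfolding right_diff_distrib mult_1_right sum_distrib_right by (simp add: mult_ac)
    also have "\<dots> = (\<Sum>i\<le>b. ?t (Suc i) * qbin M b i) + (\<Sum>i\<le>b. ?t i * fps_X ^ (M * i) * qbin M b i)"
      unfolding t by (simp add: sum_negf)
    \<comment> \<open>The added index contributes nothing since \<open>qbin M b (Suc b)\<close> is
      0; splitting off i = 0 then aligns both sums for the second Pascal rule.\<close>
    also have "(\<Sum>i\<le>b. ?t i * fps_X ^ (M * i) * qbin M b i) =
        (\<Sum>i\<le>Suc b. ?t i * fps_X ^ (M * i) * qbin M b i)"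
      by (simp add: qbin_def)
    also have "\<dots> = ?t 0 + (\<Sum>i\<le>b. ?t (Suc i) * fps_X ^ (M * Suc i) * qbin M b (Suc i))"
      using r by (subst sum.atMost_Suc_shift) simp
    also have "(\<Sum>i\<le>b. ?t (Suc i) * qbin M b i) + \<dots> =
        ?t 0 + (\<Sum>i\<le>b. ?t (Suc i) * qbin M (Suc b) (Suc i))"
      using r by (simp add: qbin_Suc_Suc(2) distrib_left sum.distrib mult.assoc del: mult_Suc_right)
    also have "\<dots> = (\<Sum>i\<le>Suc b. ?t i * qbin M (Suc b) i)"
      using r by (subst sum.atMost_Suc_shift) simp
    finally show ?case by simp
  qed
next
  case (Suc a)
  let ?t = "\<lambda>i. theta_term M r (int i - int b)" and ?n = "a + b"
  \<comment> \<open>Here the neighbour is on the right and the power is M(a + b - i), as in the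
    first Pascal rule.\<close>
  have t: "?t i * fps_X ^ (r + M * a) = - (?t (Suc i) * fps_X ^ (M * (?n - i)))" if "i \<le> ?n" for i
  proof (rule theta_term_mult[OF r])
    have n: "int (M * (?n - i)) = int M * (int a + int b - int i)" using that by (simp add: of_nat_diff)
    have "int (Suc i) - int b = (int i - int b) + 1" by simp
    then show "theta_exp M r (int i - int b) + int (r + M * a) =
          theta_exp M r (int (Suc i) - int b) + int (M * (?n - i))"
      unfolding theta_exp_def
      using arg_cong[OF tri_Suc[of "int i - int b"], of "\<lambda>x. int M * x"] n
      by (simp add: algebra_simps)
  qed simp
  have "pprod r M (Suc a) * pprod (M - r) M b =
      (\<Sum>i\<le>?n. ?t i * qbin M ?n i) * (1 - fps_X ^ (r + M * a))"
    unfolding Suc[symmetric] by (simp add: mult_ac)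
  also have "\<dots> = (\<Sum>i\<le>?n. ?t i * qbin M ?n i) - (\<Sum>i\<le>?n. (?t i * fps_X ^ (r + M * a)) * qbin M ?n i)"
    unfolding right_diff_distrib mult_1_right sum_distrib_right by (simp add: mult_ac)
  also have "(\<Sum>i\<le>?n. (?t i * fps_X ^ (r + M * a)) * qbin M ?n i) =
      - (\<Sum>i\<le>?n. ?t (Suc i) * fps_X ^ (M * (?n - i)) * qbin M ?n i)"
    unfolding sum_negf[symmetric] by (rule sum.cong) (simp_all only: atMost_iff t minus_mult_left)
  also have "(\<Sum>i\<le>?n. ?t i * qbin M ?n i) = (\<Sum>i\<le>Suc ?n. ?t i * qbin M ?n i)"
    by (simp add: qbin_def)
  also have "\<dots> = ?t 0 + (\<Sum>i\<le>?n. ?t (Suc i) * qbin M ?n (Suc i))"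
    using r by (subst sum.atMost_Suc_shift) simp
  also have "\<dots> - - (\<Sum>i\<le>?n. ?t (Suc i) * fps_X ^ (M * (?n - i)) * qbin M ?n i) =
      ?t 0 + (\<Sum>i\<le>?n. ?t (Suc i) * qbin M (Suc ?n) (Suc i))"
    using r by (simp add: qbin_Suc_Suc(1) distrib_left sum.distrib mult.assoc)
  also have "\<dots> = (\<Sum>i\<le>Suc ?n. ?t i * qbin M (Suc ?n) i)"
    using r by (subst sum.atMost_Suc_shift) simp
  finally show ?case by simp
qed

theorem jacobi_triple_product:
  assumes r: "0 < r" "r < M"
  shows "iprod r M * iprod (M - r) M * iprod M M = theta M r"
proof (rule fps_eqI_cong)
  fix N :: nat
  \<comment> \<open>With n = 2N each index i either has i and 2n - i at least N, where the binomial
    is 1/D modulo q^N, or lies at distance at least N from n, where the theta term vanishes modulo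
    q^N.\<close>
  define n where "n = 2 * N"
  let ?D = "iprod M M" and ?t = "\<lambda>i. theta_term M r (int i - int n)"
  have pos: "0 < M" using r by simp
  have D0: "fps_nth ?D 0 = 1" using pos by (rule iprod_nth_0)
  have cD: "fps_cong N (pprod M M k) ?D" if "N \<le> k" for k
    using iprod_cong[OF pos pos, of N k] that by (simp add: fps_cong_sym)
  have q: "fps_cong N (qbin M (2 * n) i * ?D) 1" if i: "N \<le> i" "i + N \<le> 2 * n" for i
  proof -
    have "fps_cong N (qbin M (2 * n) i * (?D * ?D) * inverse ?D)
            (qbin M (2 * n) i * (pprod M M i * pprod M M (2 * n - i)) * inverse ?D)"
      using i by (intro fps_cong_mult fps_cong_refl fps_cong_sym[OF cD]) auto
    also have "\<dots> = pprod M M (2 * n) * inverse ?D"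
      using i pos by (simp add: qbin_mult)
    also have "fps_cong N \<dots> (?D * inverse ?D)"
      by (intro fps_cong_mult fps_cong_refl cD) (simp add: n_def)
    also have "?D * inverse ?D = 1" using D0 by (simp add: inverse_mult_eq_1')
    finally show ?thesis using D0 by (simp add: mult.assoc inverse_mult_eq_1')
  qed
  have "fps_cong N (iprod r M * iprod (M - r) M * ?D) (pprod r M n * pprod (M - r) M n * ?D)"
    using r pos by (intro fps_cong_mult fps_cong_refl iprod_cong) (auto simp: n_def)
  also have "\<dots> = (\<Sum>i\<le>2 * n. ?t i * (qbin M (2 * n) i * ?D))"
    by (simp add: finite_triple_product[OF r] sum_distrib_right mult.assoc mult_2)
  also have "fps_cong N \<dots> (\<Sum>i\<le>2 * n. ?t i * 1)"
  proof (rule fps_cong_sum)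
    fix i assume "i \<in> {..2 * n}"
    show "fps_cong N (?t i * (qbin M (2 * n) i * ?D)) (?t i * 1)"
    proof (cases "N \<le> i \<and> i + N \<le> 2 * n")
      case True
      then show ?thesis using q by (intro fps_cong_mult) auto
    next
      case False
      then have "int N \<le> \<bar>int i - int n\<bar>" by (auto simp: n_def)
      then have "N \<le> nat (theta_exp M r (int i - int n))"
        using theta_exp_ge[OF r, of "int i - int n"] by linarith
      then have z: "fps_cong N (?t i * F) 0" for F
        using fps_cong_X_power[of N "nat (theta_exp M r (int i - int n))" "fps_const (sg (int i - int n)) * F"]
        by (simp add: theta_term_def mult_ac)
      show ?thesis using z[of 1] z by (blast intro: fps_cong_trans fps_cong_sym)
    qed
  qed
  also have "fps_cong N \<dots> (theta M r)"
    unfolding fps_cong_def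
  proof (intro allI impI)
    fix l assume l: "l < N"
    have "fps_nth (\<Sum>i\<le>2 * n. ?t i * 1) l =
        (\<Sum>i\<le>2 * n. if theta_exp M r (int i - int n) = int l then sg (int i - int n) else 0)"
      unfolding fps_sum_nth
    proof (intro sum.cong refl)
      fix i
      have "0 \<le> theta_exp M r (int i - int n)" using theta_exp_ge[OF r, of "int i - int n"] by linarith
      then show "fps_nth (?t i * 1) l =
          (if theta_exp M r (int i - int n) = int l then sg (int i - int n) else 0)"
        by (auto simp: theta_term_def fps_X_power_nth)
    qed
    also have "\<dots> = (\<Sum>i | i \<in> {..2 * n} \<and> theta_exp M r (int i - int n) = int l. sg (int i - int n))"
      by (rule sum.inter_filter[symmetric]) simp
    also have "\<dots> = (\<Sum>j | j \<in> UNIV \<and> theta_exp M r j = int l. sg j)"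
    proof (rule sum.reindex_bij_witness[where i = "\<lambda>j. nat (j + int n)" and j = "\<lambda>i. int i - int n"])
      \<comment> \<open>An index contributing to a coefficient below N has absolute value below n,
        so the finite window misses none.\<close>
      fix j assume "j \<in> {j \<in> UNIV. theta_exp M r j = int l}"
      then have "\<bar>j\<bar> < int n" using theta_exp_ge[OF r, of j] l by (auto simp: n_def)
      then show "int (nat (j + int n)) - int n = j"
        "nat (j + int n) \<in> {i \<in> {..2 * n}. theta_exp M r (int i - int n) = int l}"
        using \<open>j \<in> _\<close> by auto
    qed auto
    finally show "fps_nth (\<Sum>i\<le>2 * n. ?t i * 1) l = fps_nth (theta M r) l"
      by (simp add: theta_def fsum_nth)
  qed
  finally show "fps_cong N (iprod r M * iprod (M - r) M * ?D) (theta M r)" .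
qed

section \<open>Splitting products and theta series by residue classes\<close>

lemma fps_cong_prod:
  assumes "\<And>x. x \<in> A \<Longrightarrow> fps_cong N (f x) (g x)"
  shows "fps_cong N (\<Prod>x\<in>A. f x) (\<Prod>x\<in>A. g x)"
  using assms by (induction A rule: infinite_finite_induct) (auto intro: fps_cong_mult)

lemma pprod_add: "pprod r M (m + c) = pprod r M m * (\<Prod>i<c. 1 - fps_X ^ (r + M * (m + i)))"
  by (induction c) (auto simp: mult.assoc)

text \<open>Factors are sorted by their index modulo c; each induction step adds a block of c
  consecutive factors, one per class.\<close>

lemma pprod_dissect: "pprod r M (n * c) = (\<Prod>i<c. pprod (r + M * i) (c * M) n)"
proof (induction n)
  case (Suc n)
  have "pprod r M (Suc n * c) = pprod r M (n * c) * (\<Prod>i<c. 1 - fps_X ^ (r + M * (n * c + i)))"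
    by (metis mult_Suc add.commute pprod_add)
  also have "\<dots> = (\<Prod>i<c. pprod (r + M * i) (c * M) n * (1 - fps_X ^ (r + M * (n * c + i))))"
    by (simp add: Suc prod.distrib)
  also have "\<dots> = (\<Prod>i<c. pprod (r + M * i) (c * M) (Suc n))"
    by (simp add: algebra_simps)
  finally show ?case .
qed simp

lemma iprod_dissect:
  assumes "0 < r" "0 < M" "0 < c"
  shows "iprod r M = (\<Prod>i<c. iprod (r + M * i) (c * M))"
proof (rule fps_eqI_cong)
  fix N
  have "fps_cong N (iprod r M) (pprod r M (N * c))"
    using assms by (intro iprod_cong) (simp_all add: le_SucI)
  also have "fps_cong N \<dots> (\<Prod>i<c. iprod (r + M * i) (c * M))"
    unfolding pprod_dissect using assms
    by (intro fps_cong_prod fps_cong_sym[OF iprod_cong]) simp_all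
  finally show "fps_cong N (iprod r M) (\<Prod>i<c. iprod (r + M * i) (c * M))" .
qed

text \<open>The multiples of d fall into the classes d, 2d, 3d modulo 3d, which form a Jacobi triple
  product.\<close>

theorem pentagonal_number_theorem:
  assumes "0 < d"
  shows "iprod d d = theta (3 * d) d"
proof -
  have "iprod d d = iprod d (3 * d) * iprod (3 * d - d) (3 * d) * iprod (3 * d) (3 * d)"
    using iprod_dissect[OF assms assms, of 3] by (simp add: eval_nat_numeral add_ac)
  then show ?thesis using jacobi_triple_product[of d "3 * d"] assms by simp
qed

text \<open>Classes 0 and 2 of the index modulo 5 form the first \<open>quint\<close>, class 1 the
  middle term, and classes 4 and 3 the second \<open>quint\<close>.\<close>

lemma theta_dissect_5: "theta 3 1 = quint 25 5 - fps_X * theta 75 25 - fps_X ^ 2 * quint 25 10"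
proof -
  let ?e = "theta_exp 3 1"
  define R where "R i = {j :: int. j mod 5 = i}" for i
  have sum: "summable_exp ?e UNIV" by (rule summable_exp_theta) auto
  have U: "UNIV = R 0 \<union> (R 1 \<union> (R 2 \<union> (R 3 \<union> R 4)))"
    by (auto simp: R_def)
  have *: "theta 3 1 = fsum ?e sg (R 0) + (fsum ?e sg (R 1) + (fsum ?e sg (R 2) +
      (fsum ?e sg (R 3) + fsum ?e sg (R 4))))"
    unfolding theta_def U by (subst fsum_Un[OF sum], force simp: R_def)+ simp
  have bij: "bij_betw (\<lambda>k. 5 * k + c) UNIV (R i)" "bij_betw (\<lambda>k. c - 5 * k) UNIV (R i)"
    if "c mod 5 = i" for c i
  proof -
    show "bij_betw (\<lambda>k. 5 * k + c) UNIV (R i)"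
      by (rule bij_betw_byWitness[where f' = "\<lambda>j. (j - c) div 5"])
        (use that in \<open>auto simp: R_def mod_eq_dvd_iff elim!: dvdE\<close>)
    show "bij_betw (\<lambda>k. c - 5 * k) UNIV (R i)"
    proof (rule bij_betw_byWitness[where f' = "\<lambda>j. (c - j) div 5"])
      have "5 dvd c - j" if "j \<in> R i" for j
        using that \<open>c mod 5 = i\<close> by (simp add: R_def flip: mod_eq_dvd_iff)
      then show "\<forall>j\<in>R i. c - 5 * ((c - j) div 5) = j" by auto
    qed (use that in \<open>auto simp: R_def mod_eq_dvd_iff\<close>)
  qed
  have tri: "2 * tri j = j * j - j" for j using two_tri[of j] by (simp add: algebra_simps)
  have e: "2 * ?e j = 3 * (j * j) - j" for j
    using tri[of j] by (simp add: theta_exp_def)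
  have q1: "2 * quint_exp1 25 s k = 75 * (k * k) - 25 * k + 6 * (int s * k)" for s k
    using tri[of k] by (simp add: quint_exp1_def algebra_simps)
  have q2: "2 * quint_exp2 25 s k = 75 * (k * k) - 125 * k + 6 * (int s * k) + 50 - 4 * int s" for s k
    using tri[of k] by (simp add: quint_exp2_def algebra_simps)
  have t: "2 * theta_exp 75 25 k = 75 * (k * k) - 25 * k" for k
    using tri[of k] by (simp add: theta_exp_def algebra_simps)
  have 0: "fsum ?e sg (R 0) = fsum (quint_exp1 25 5) sg UNIV"
  proof (rule fsum_reindex[OF bij(2)[of 0]])
    fix k show "?e (0 - 5 * k) = quint_exp1 25 5 k"
      using e[of "0 - 5 * k"] q1[of 5 k] by (simp add: algebra_simps)
  qed (auto simp: sg_def)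
  have 2: "fsum ?e sg (R 2) = fsum (quint_exp2 25 5) (\<lambda>k. - sg k) UNIV"
  \<comment> \<open>The representative -3 of class 2 makes the exponents match without a further
    shift; the other representatives are chosen likewise.\<close>
  proof (rule fsum_reindex[OF bij(1)[of "-3"]])
    fix k show "?e (5 * k + -3) = quint_exp2 25 5 k"
      using e[of "5 * k + -3"] q2[of 5 k] by (simp add: algebra_simps)
  qed (auto simp: sg_def)
  have 1: "fsum ?e sg (R 1) = fsum (\<lambda>k. int 1 + theta_exp 75 25 k) (\<lambda>k. - sg k) UNIV"
  proof (rule fsum_reindex[OF bij(2)[of 1]])
    fix k show "?e (1 - 5 * k) = int 1 + theta_exp 75 25 k"
      using e[of "1 - 5 * k"] t[of k] by (simp add: algebra_simps)
  qed (auto simp: sg_def)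
  have 4: "fsum ?e sg (R 4) = fsum (\<lambda>k. int 2 + quint_exp1 25 10 k) (\<lambda>k. - sg k) UNIV"
  proof (rule fsum_reindex[OF bij(2)[of "-1"]])
    fix k show "?e (-1 - 5 * k) = int 2 + quint_exp1 25 10 k"
      using e[of "-1 - 5 * k"] q1[of 10 k] by (simp add: algebra_simps)
  qed (auto simp: sg_def)
  have 3: "fsum ?e sg (R 3) = fsum (\<lambda>k. int 2 + quint_exp2 25 10 k) sg UNIV"
  proof (rule fsum_reindex[OF bij(1)[of "-2"]])
    fix k show "?e (5 * k + -2) = int 2 + quint_exp2 25 10 k"
      using e[of "5 * k + -2"] q2[of 10 k] by (simp add: algebra_simps)
  qed (auto simp: sg_def)
  have X: "fsum (\<lambda>k. int 1 + theta_exp 75 25 k) c UNIV = fps_X ^ 1 * fsum (theta_exp 75 25) c UNIV"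
    "fsum (\<lambda>k. int 2 + quint_exp1 25 10 k) c UNIV = fps_X ^ 2 * fsum (quint_exp1 25 10) c UNIV"
    "fsum (\<lambda>k. int 2 + quint_exp2 25 10 k) c UNIV = fps_X ^ 2 * fsum (quint_exp2 25 10) c UNIV" for c
    by (intro fsum_X_power summable_exp_theta summable_exp_quint1 summable_exp_quint2; simp)+
  show ?thesis
    unfolding * 0 1 2 3 4 X fsum_uminus by (simp add: quint_def theta_def right_diff_distrib)
qed

section \<open>Positivity\<close>

text \<open>The positive constant term is what lets such a factor preserve strict positivity in
  \<open>pos_in_mult\<close>.\<close>

definition nonneg_in :: "nat \<Rightarrow> real fps \<Rightarrow> bool" where
  "nonneg_in d F \<longleftrightarrow> 0 < fps_nth F 0 \<and> (\<forall>n. 0 \<le> fps_nth F n \<and> (\<not> d dvd n \<longrightarrow> fps_nth F n = 0))"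

definition pos_in :: "nat \<Rightarrow> real fps \<Rightarrow> bool" where
  "pos_in d F \<longleftrightarrow> nonneg_in d F \<and> (\<forall>n. d dvd n \<longrightarrow> 0 < fps_nth F n)"

lemma nonneg_in_1: "nonneg_in d 1"
  by (auto simp: nonneg_in_def)

lemma nonneg_in_mult:
  assumes "nonneg_in d F" "nonneg_in d G"
  shows "nonneg_in d (F * G)"
  unfolding nonneg_in_def
proof (intro conjI allI impI)
  show "0 < fps_nth (F * G) 0" using assms by (simp add: nonneg_in_def)
  fix n
  show "0 \<le> fps_nth (F * G) n"
    using assms by (auto simp: fps_mult_nth nonneg_in_def intro!: sum_nonneg)
  assume n: "\<not> d dvd n"
  have "fps_nth F i * fps_nth G (n - i) = 0" if "i \<le> n" for i
    using n that assms dvd_add[of d i "n - i"] by (auto simp: nonneg_in_def)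
  then show "fps_nth (F * G) n = 0" unfolding fps_mult_nth by (intro sum.neutral) simp
qed

lemma nonneg_in_power: "nonneg_in d F \<Longrightarrow> nonneg_in d (F ^ k)"
  by (induction k) (auto intro: nonneg_in_mult nonneg_in_1)

text \<open>The single term F_n G_0 of the convolution is positive, and the rest are
  nonnegative.\<close>

lemma pos_in_mult:
  assumes "pos_in d F" "nonneg_in d G"
  shows "pos_in d (F * G)"
  unfolding pos_in_def
proof (intro conjI allI impI)
  show "nonneg_in d (F * G)" using assms by (auto simp: pos_in_def intro: nonneg_in_mult)
  fix n assume "d dvd n"
  then have "0 < fps_nth F n * fps_nth G (n - n)" using assms by (simp add: pos_in_def nonneg_in_def)
  also have "\<dots> \<le> fps_nth (F * G) n" unfolding fps_mult_nth
    by (rule member_le_sum) (use assms in \<open>auto simp: pos_in_def nonneg_in_def\<close>)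
  finally show "0 < fps_nth (F * G) n" .
qed

lemma inverse_one_minus_X_power:
  assumes "0 < m"
  shows "inverse (1 - fps_X ^ m :: real fps) = Abs_fps (\<lambda>n. if m dvd n then 1 else 0)" (is "_ = ?G")
proof (rule fps_inverse_unique)
  show "(1 - fps_X ^ m) * ?G = 1"
    using assms by (auto simp: fps_eq_iff left_diff_distrib fps_X_power_mult_nth dvd_diff_nat not_less
        dest: dvd_imp_le dvd_diffD[of m _ m])
qed

lemma inverse_pprod_Suc:
  "inverse (pprod r M (Suc n)) = inverse (pprod r M n) * inverse (1 - fps_X ^ (r + M * n))"
  by (simp add: fps_inverse_mult)

lemma nonneg_in_inverse_factor:
  "0 < m \<Longrightarrow> d dvd m \<Longrightarrow> nonneg_in d (inverse (1 - fps_X ^ m))"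
  by (auto simp: inverse_one_minus_X_power nonneg_in_def intro: dvd_trans)

lemma nonneg_in_inverse_pprod:
  assumes "0 < r" "d dvd r" "d dvd M"
  shows "nonneg_in d (inverse (pprod r M n))"
  using assms by (induction n)
    (auto simp: nonneg_in_1 inverse_pprod_Suc simp del: pprod_Suc
      intro!: nonneg_in_mult nonneg_in_inverse_factor)

text \<open>The first factor alone contributes 1/(1 - q^d), positive at every multiple of d;
  \<open>Suc n\<close> ensures that it is present.\<close>

lemma pos_in_inverse_pprod:
  assumes "0 < d" "d dvd M"
  shows "pos_in d (inverse (pprod d M (Suc n)))"
proof (induction n)
  case 0
  show ?case using assms by (auto simp: inverse_one_minus_X_power pos_in_def nonneg_in_def)
next
  case (Suc n)
  then show ?case unfolding inverse_pprod_Suc[of d M "Suc n"]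
    using assms by (intro pos_in_mult nonneg_in_inverse_factor) auto
qed

lemma inverse_iprod_nth:
  assumes "0 < r" "0 < M"
  shows "fps_nth (inverse (iprod r M)) n = fps_nth (inverse (pprod r M (Suc n))) n"
proof -
  have "fps_cong (Suc n) (inverse (iprod r M)) (inverse (pprod r M (Suc n)))"
    using assms by (intro fps_cong_inverse iprod_cong) (auto simp: iprod_nth_0 pprod_nth_0 simp del: pprod_Suc)
  then show ?thesis by (simp add: fps_cong_def)
qed

lemma nonneg_in_inverse_iprod:
  assumes "0 < r" "0 < M" "d dvd r" "d dvd M"
  shows "nonneg_in d (inverse (iprod r M))"
  using nonneg_in_inverse_pprod[OF assms(1,3,4)] unfolding nonneg_in_def inverse_iprod_nth[OF assms(1,2)]
  by blast

lemma pos_in_inverse_iprod: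
  assumes "0 < d" "0 < M" "d dvd M"
  shows "pos_in d (inverse (iprod d M))"
  using pos_in_inverse_pprod[OF assms(1,3)]
  unfolding pos_in_def nonneg_in_def inverse_iprod_nth[OF assms(1,2)] by blast

lemma pos_in_X_power_mult:
  assumes "pos_in d F" "i < d"
  shows "n mod d = i \<Longrightarrow> 0 < fps_nth (fps_X ^ i * F) n" and "n mod d \<noteq> i \<Longrightarrow> fps_nth (fps_X ^ i * F) n = 0"
proof -
  assume "n mod d = i"
  then show "0 < fps_nth (fps_X ^ i * F) n"
    using assms mod_less_eq_dividend[of n d] by (auto simp: fps_X_power_mult_nth pos_in_def dvd_minus_mod not_less)
next
  assume n: "n mod d \<noteq> i"
  have "\<not> d dvd n - i" if "i \<le> n"
    using n assms(2) mod_eq_dvd_iff_nat[OF that, of d] by simp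
  then show "fps_nth (fps_X ^ i * F) n = 0"
    using assms by (auto simp: fps_X_power_mult_nth pos_in_def nonneg_in_def)
qed

section \<open>The five signed terms of the series\<close>

lemma thm_series_dissect:
  obtains G0 G1 G2 G3 G4 where "pos_in 5 G0" "pos_in 5 G1" "pos_in 5 G2" "pos_in 5 G3" "pos_in 5 G4"
    "thm_series = fps_X ^ 0 * G0 - fps_X ^ 1 * G1 - fps_X ^ 1 * G1 - fps_X ^ 2 * G2
      + fps_X ^ 3 * G3 + fps_X ^ 3 * G3 + fps_X ^ 4 * G4"
proof -
  define A where "A = iprod 5 25 * iprod 20 25"
  define B where "B = iprod 10 25 * iprod 15 25"
  define F where "F = iprod 25 25"
  define a b f where "a = inverse A" and "b = inverse B" and "f = inverse F"
  have nz: "fps_nth A 0 \<noteq> 0" "fps_nth B 0 \<noteq> 0" "fps_nth F 0 \<noteq> 0"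
    by (simp_all add: A_def B_def F_def iprod_nth_0)
  then have nz': "A \<noteq> 0" "B \<noteq> 0" "F \<noteq> 0" by auto
  have inv: "A * a = 1" "B * b = 1" "F * f = 1"
    using nz by (simp_all add: a_def b_def f_def inverse_mult_eq_1')
  \<comment> \<open>The triple product is symmetric under r -> 25 - r; \<open>theta 25 20\<close>
    arises as \<open>theta M (2 * s)\<close> for s = 10.\<close>
  have tA: "theta 25 5 = A * F" and tA': "theta 25 20 = A * F" and tB: "theta 25 10 = B * F"
    using jacobi_triple_product[of 5 25] jacobi_triple_product[of 20 25] jacobi_triple_product[of 10 25]
    by (simp_all add: A_def B_def F_def mult_ac)
  have tF: "theta 75 25 = F" using pentagonal_number_theorem[of 25] by (simp add: F_def)
  have "(A * F) * quint 25 5 = (A * F) * (F * B * a)"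
    using quintuple_product[of 5 25] inv(1)
    by (simp add: tA tB tF mult_ac) (metis inv(1) mult.left_commute mult_1_right)
  then have q1: "quint 25 5 = F * B * a" using nz' by simp
  have "(B * F) * quint 25 10 = (B * F) * (F * A * b)"
    using quintuple_product[of 10 25] inv(2)
    by (simp add: tA' tB tF mult_ac) (metis inv(2) mult.left_commute mult_1_right)
  then have q2: "quint 25 10 = F * A * b" using nz' by simp
  have f1: "qpoch_inf_fps 1 = F * (B * a - fps_X - fps_X ^ 2 * (A * b))"
    using pentagonal_number_theorem[of 1] theta_dissect_5
    by (simp add: qpoch_inf_fps_eq_iprod q1 q2 tF algebra_simps)
  have "iprod 5 5 = iprod 5 25 * iprod 10 25 * iprod 15 25 * iprod 20 25 * iprod 25 25"
    using iprod_dissect[of 5 5 5] by (simp add: eval_nat_numeral)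
  then have f5: "inverse (qpoch_inf_fps 5) = a * b * f"
    by (simp add: qpoch_inf_fps_eq_iprod A_def B_def F_def a_def b_def f_def fps_inverse_mult mult_ac)
  \<comment> \<open>At least one factor a is required: it contains 1/(q^5; q^25), which is positive
    at all multiples of 5.\<close>
  have pos: "pos_in 5 (a ^ Suc i * b ^ j * f)" for i j
    unfolding a_def b_def f_def A_def B_def F_def fps_inverse_mult power_Suc
    by (intro pos_in_mult nonneg_in_mult nonneg_in_power pos_in_inverse_iprod nonneg_in_inverse_iprod) auto
  \<comment> \<open>In the square, x^2 has coefficient 1 - 2 = -1: the middle term squared plus
    twice the product of the outer ones, where A a = B b = 1.\<close>
  have alg: "(F * (B * a - x - x ^ 2 * (A * b))) ^ 2 * (a * b * f) ^ 3 =
     x ^ 0 * (a ^ 5 * b ^ 1 * f) - x ^ 1 * (a ^ 4 * b ^ 2 * f) - x ^ 1 * (a ^ 4 * b ^ 2 * f)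
     - x ^ 2 * (a ^ 3 * b ^ 3 * f) + x ^ 3 * (a ^ 2 * b ^ 4 * f) + x ^ 3 * (a ^ 2 * b ^ 4 * f)
     + x ^ 4 * (a ^ 1 * b ^ 5 * f)" for x
    using inv by algebra
  show ?thesis
  proof (rule that)
    show "thm_series = fps_X ^ 0 * (a ^ 5 * b ^ 1 * f) - fps_X ^ 1 * (a ^ 4 * b ^ 2 * f)
     - fps_X ^ 1 * (a ^ 4 * b ^ 2 * f) - fps_X ^ 2 * (a ^ 3 * b ^ 3 * f)
     + fps_X ^ 3 * (a ^ 2 * b ^ 4 * f) + fps_X ^ 3 * (a ^ 2 * b ^ 4 * f)
     + fps_X ^ 4 * (a ^ 1 * b ^ 5 * f)"
      unfolding thm_series_def f1 fps_inverse_power f5 by (rule alg)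
  qed (use pos[of 4 1] pos[of 3 2] pos[of 2 3] pos[of 1 4] pos[of 0 5] in \<open>simp_all add: eval_nat_numeral\<close>)
qed

theorem theorem1p3:
  fixes n :: nat
  shows "(n mod 5 \<in> {0, 3, 4} \<longrightarrow> fps_nth thm_series n > 0) \<and>
         (n mod 5 \<in> {1, 2} \<longrightarrow> fps_nth thm_series n < 0)"
proof -
  obtain G0 G1 G2 G3 G4 where G: "pos_in 5 G0" "pos_in 5 G1" "pos_in 5 G2" "pos_in 5 G3" "pos_in 5 G4"
    and eq: "thm_series = fps_X ^ 0 * G0 - fps_X ^ 1 * G1 - fps_X ^ 1 * G1 - fps_X ^ 2 * G2
      + fps_X ^ 3 * G3 + fps_X ^ 3 * G3 + fps_X ^ 4 * G4"
    by (rule thm_series_dissect)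
  note c = pos_in_X_power_mult[OF G(1), of 0 n] pos_in_X_power_mult[OF G(2), of 1 n]
    pos_in_X_power_mult[OF G(3), of 2 n] pos_in_X_power_mult[OF G(4), of 3 n]
    pos_in_X_power_mult[OF G(5), of 4 n]
  have "fps_nth thm_series n = fps_nth (fps_X ^ 0 * G0) n - 2 * fps_nth (fps_X ^ 1 * G1) n
      - fps_nth (fps_X ^ 2 * G2) n + 2 * fps_nth (fps_X ^ 3 * G3) n + fps_nth (fps_X ^ 4 * G4) n"
    unfolding eq by (simp only: fps_add_nth fps_sub_nth)
  \<comment> \<open>For each residue exactly one of the five terms is nonzero. Keeping the powers 0
    and 1 unsimplified lets the facts in \<open>c\<close> match.\<close>
  then show ?thesis using c by (elim ssubst) (auto simp del: power_0 power_one_right)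
qed

end
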